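(* No number of the form $2^{n-1}$, where $n$ is a positive integer, is expressible as a sum of consecutive positive integers.
   Context: A sum of consecutive positive integers is a sum $a+(a+1)+\cdots+(a+r-1)$ with $r\ge 2$ terms, where $a$ is a positive integer. *)

theory Defs
  imports Main
begin

definition sum_of_consecutive_pos :: "nat \<Rightarrow> bool" where
  "sum_of_consecutive_pos m \<longleftrightarrow>
     (\<exists>a r :: nat. a \<ge> 1 \<and> r \<ge> 2 \<and> m = (\<Sum>i<r. a + i))"

end

theory Submission
  imports Defs
begin

text \<open>
  Twice the sum of \<open>r\<close> consecutive integers starting at \<open>a\<close> is \<open>r * (2 * a + r - 1)\<close>. The two
  factors differ by the odd number \<open>2 * a - 1\<close>, so one of them is odd; and both exceed \<open>1\<close> when
  \<open>a \<ge> 1\<close> and \<open>r \<ge> 2\<close>. If the sum were a power of two, so would be its double, yet the only odd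
  divisor of a power of two is \<open>1\<close>.
\<close>

lemma double_sum_consecutive:
  fixes a r :: nat
  shows "2 * (\<Sum>i<Suc r. a + i) = Suc r * (2 * a + r)"
  by (induction r) (auto simp: algebra_simps)

lemma odd_dvd_power_2_imp_eq_1:
  fixes d :: nat
  assumes "odd d" and "d dvd 2 ^ k"
  shows "d = 1"
proof -
  have "coprime d (2 ^ k)"
    using \<open>odd d\<close> by simp
  then show ?thesis
    using coprime_common_divisor[OF _ dvd_refl \<open>d dvd 2 ^ k\<close>] by simp
qed

theorem theorem2:
  fixes n :: nat
  assumes "n \<ge> 1"
  shows "\<not> sum_of_consecutive_pos (2 ^ (n - 1))"
proof
  assume "sum_of_consecutive_pos (2 ^ (n - 1))"
  then obtain a r :: nat where "a \<ge> 1" "r \<ge> 2" and sum: "2 ^ (n - 1) = (\<Sum>i<r. a + i)"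
    by (auto simp: sum_of_consecutive_pos_def)
  \<comment> \<open>Writing the number of terms as a successor avoids truncated subtraction in \<open>2 * a + r - 1\<close>.\<close>
  from \<open>r \<ge> 2\<close> obtain s where r: "r = Suc s" and "s \<ge> 1"
    by (cases r) auto
  have "2 * 2 ^ (n - 1) = Suc s * (2 * a + s)"
    unfolding sum r by (rule double_sum_consecutive)
  then have factors: "2 ^ Suc (n - 1) = Suc s * (2 * a + s)"
    by simp
  then have dvd: "Suc s dvd 2 ^ Suc (n - 1)" "2 * a + s dvd 2 ^ Suc (n - 1)"
    by (metis dvd_triv_left, metis dvd_triv_right)
  have "odd (Suc s) \<or> odd (2 * a + s)"
    by simp
  then have "Suc s = 1 \<or> 2 * a + s = 1"
    using dvd odd_dvd_power_2_imp_eq_1 by blast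
  with \<open>a \<ge> 1\<close> \<open>s \<ge> 1\<close> show False
    by simp
qed

end
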